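(* Let $p\geq 1$ be an integer, let $r_1,\dots,r_p$ be positive integers, and let $z_1,\dots,z_p\in(-1,1)$ be pairwise distinct. Let $\theta_1,\dots,\theta_p$ be independent and uniformly distributed in $[0,2\pi]$. Then the expected $2$-energy of the random configuration $\Omega(p,\{r_j\},\{z_j\})$ is $$\mathbb{E}_{\theta_1,\dots,\theta_p}\bigl[E_2(\Omega(p,\{r_j\},\{z_j\}))\bigr]=\frac12+\frac{23}{12}\sum_{j=1}^{p}\frac{r_j}{1-z_j^2}+\frac1{12}\sum_{j=1}^{p}\frac{r_j^3}{1-z_j^2}+\frac12\sum_{\substack{j,k=1\\ j\neq k}}^{p}\frac{r_jr_k}{|z_j-z_k|}.$$
   Context: For a finite set $\omega=\{x_1,\dots,x_N\}$ of points on the unit sphere $\mathbb{S}^2\subset\mathbb{R}^3$, $E_2(\omega)=\sum_{i\neq j}\|x_i-x_j\|^{-2}$ (sum over ordered pairs of distinct indices, Euclidean norm). $\Omega(p,\{r_j\},\{z_j\})$ is the set consisting of the poles $(0,0,1)$ and $(0,0,-1)$ together with the points $$x_j^{\ell}=\Bigl(\sqrt{1-z_j^2}\cos\bigl(\tfrac{2\pi\ell}{r_j}+\theta_j\bigr),\ \sqrt{1-z_j^2}\sin\bigl(\tfrac{2\pi\ell}{r_j}+\theta_j\bigr),\ z_j\Bigr),\qquad 1\le j\le p,\ 1\le\ell\le r_j,$$ where $\theta_j$ is the random phase of the $j$th parallel. *)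

theory Defs
  imports "HOL-Probability.Probability"
begin

text \<open>
  The points are enumerated without repetition, so the sum over ordered pairs of distinct
  indices is the sum over ordered pairs of distinct points.
\<close>

definition energy2 :: "(real ^ 3) set \<Rightarrow> real" where
  "energy2 \<omega> = (\<Sum>(x, y) \<in> {(x, y). x \<in> \<omega> \<and> y \<in> \<omega> \<and> x \<noteq> y}. 1 / norm (x - y) ^ 2)"

text \<open>
  The height is \<open>z\<close>, the number of points on the parallel is \<open>r\<close>, and \<open>\<phi>\<close> is the phase.
\<close>

definition parallel_point :: "nat \<Rightarrow> real \<Rightarrow> real \<Rightarrow> nat \<Rightarrow> real ^ 3" where
  "parallel_point r z \<phi> l =
     vector [sqrt (1 - z\<^sup>2) * cos (2 * pi * real l / real r + \<phi>),
             sqrt (1 - z\<^sup>2) * sin (2 * pi * real l / real r + \<phi>),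
             z]"

definition parallel_config ::
    "nat \<Rightarrow> (nat \<Rightarrow> nat) \<Rightarrow> (nat \<Rightarrow> real) \<Rightarrow> (nat \<Rightarrow> real) \<Rightarrow> (real ^ 3) set" where
  "parallel_config p r z \<phi> =
     {vector [0, 0, 1], vector [0, 0, -1]} \<union>
     {parallel_point (r j) (z j) (\<phi> j) l | j l. j \<in> {1..p} \<and> l \<in> {1..r j}}"

end

theory Submission imports Defs
begin

text \<open>
  By linearity the expected energy is a sum over the kinds of pairs of points, and only one kind is
  random. The pair of poles contributes \<open>1 / 2\<close>, and the pairs of a pole and a point at height \<open>z\<^sub>j\<close>
  contribute \<open>2 r\<^sub>j / (1 - z\<^sub>j\<^sup>2)\<close> in total.

  The points of one parallel are the \<open>r\<close>-th roots of unity, rotated and scaled by \<open>sqrt (1 - z\<^sup>2)\<close>. The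
  energy of the roots of unity is \<open>(r\<^sup>3 - r) / 12\<close> (\<open>energy_roots_of_unity\<close>). This follows from
  Parseval's identity, because on the nontrivial roots of unity \<open>1 / (1 - w)\<close> is, up to the factor
  \<open>- 1 / r\<close>, the discrete Fourier transform of the sequence \<open>0, 1, \<dots>, r - 1\<close>.

  For two points on different parallels, the difference of the two azimuths is uniform modulo \<open>2 \<pi>\<close>,
  whatever the two indices are. The mean of \<open>1 / (a - b cos t)\<close> over a period is
  \<open>1 / sqrt (a\<^sup>2 - b\<^sup>2)\<close> (\<open>integral_inverse_cos_over_period\<close>), and for the squared distance of points
  at heights \<open>z\<close> and \<open>z'\<close> this square root is \<open>2 |z - z'|\<close>
  (\<open>expectation_inverse_norm_parallel_points\<close>).
\<close>

section \<open>The energy of the roots of unity\<close>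

text \<open>
  The points of a parallel are numbered \<open>1, \<dots>, r\<close>, so the root \<open>1\<close> carries the index \<open>r\<close> instead
  of \<open>0\<close>.
\<close>

lemma bij_betw_root_of_unity_index:
  assumes "r > 0"
  shows "bij_betw (\<lambda>l. cis (2 * pi * real l / real r)) {1..r} {w. w ^ r = 1}"
proof -
  let ?f = "\<lambda>l. cis (2 * pi * real l / real r)"
  have "{1..r} = insert r {1..<r}" "{..<r} = insert 0 {1..<r}"
    using assms by auto
  moreover have "?f r = ?f 0"
    using assms by simp
  ultimately have img: "?f ` {1..r} = ?f ` {..<r}"
    by (simp only: image_insert)
  also have "\<dots> = {w. w ^ r = 1}"
    using Complex.bij_betw_roots_unity[OF assms] by (simp add: bij_betw_def)
  finally have "?f ` {1..r} = {w. w ^ r = 1}" .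
  moreover have "card {w :: complex. w ^ r = 1} = card {1..r}"
    using card_roots_unity_eq[OF assms] by simp
  ultimately show ?thesis
    by (auto simp: bij_betw_def intro!: eq_card_imp_inj_on)
qed

lemma bij_betw_mult_roots_of_unity:
  fixes \<zeta> :: complex
  assumes "\<zeta> ^ r = 1" "r > 0"
  shows "bij_betw ((*) \<zeta>) {w. w ^ r = 1} {w. w ^ r = 1}"
proof (rule bij_betw_byWitness[where f' = "\<lambda>w. w / \<zeta>"])
  have "\<zeta> \<noteq> 0"
    using assms by (metis power_0_left zero_neq_one less_numeral_extra(3))
  then show "\<forall>w\<in>{w. w ^ r = 1}. \<zeta> * w / \<zeta> = w" "\<forall>w\<in>{w. w ^ r = 1}. \<zeta> * (w / \<zeta>) = w"
    by auto
qed (use assms in \<open>auto simp: power_mult_distrib power_divide\<close>)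

text \<open>
  Multiplication by a primitive root permutes the roots of unity and multiplies the sum by a number
  different from \<open>1\<close>, hence the sum vanishes.
\<close>

lemma roots_of_unity_orthogonal:
  assumes "k < r" "m < r" "k \<noteq> m"
  shows "(\<Sum>w | w ^ r = 1. w ^ k * cnj (w ^ m)) = (0 :: complex)"
proof -
  define \<zeta> where "\<zeta> = cis (2 * pi / real r)"
  have r: "r > 0"
    using assms by simp
  have pow: "\<zeta> ^ n = cis (2 * pi * real n / real r)" for n
    by (simp add: \<zeta>_def Complex.DeMoivre mult.commute)
  have \<zeta>1: "\<zeta> ^ r = 1"
    using r by (simp add: pow)
  have "\<zeta> ^ k \<noteq> \<zeta> ^ m"
    using Complex.bij_betw_roots_unity[OF r] assms
    unfolding pow bij_betw_def inj_on_def by blast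
  moreover have "\<zeta> ^ m * cnj (\<zeta> ^ m) = 1"
    by (simp add: pow cis_cnj cis_mult)
  ultimately have ne: "\<zeta> ^ k * cnj (\<zeta> ^ m) \<noteq> 1"
    by (metis complex_cnj_zero mult_cancel_right mult_zero_right zero_neq_one)
  let ?S = "\<Sum>w | w ^ r = 1. w ^ k * cnj (w ^ m)"
  have "?S = (\<Sum>w | w ^ r = 1. (\<zeta> * w) ^ k * cnj ((\<zeta> * w) ^ m))"
    by (rule sum.reindex_bij_betw[symmetric]) (rule bij_betw_mult_roots_of_unity[OF \<zeta>1 r])
  also have "\<dots> = \<zeta> ^ k * cnj (\<zeta> ^ m) * ?S"
    by (simp add: sum_distrib_left power_mult_distrib mult_ac)
  finally show ?thesis
    using ne unfolding mult_cancel_right1 by blast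
qed

text \<open>
  For \<open>w \<noteq> 1\<close> the geometric sum on the right is \<open>0\<close>, so this is the discrete Fourier expansion
  \<open>1 / (1 - w) = - (1 / r) (\<Sum>k<r. k w\<^sup>k)\<close>.
\<close>

lemma sum_index_power_root_of_unity:
  fixes w :: complex
  assumes "w ^ r = 1"
  shows "(\<Sum>k<r. of_nat k * w ^ k) * (1 - w) = (\<Sum>k<r. w ^ k) - of_nat r"
proof -
  have "(\<Sum>k<n. of_nat k * w ^ k) * (1 - w) = (\<Sum>k<n. w ^ k) - of_nat n * w ^ n + w ^ n - 1" for n
    by (induction n) (auto simp: algebra_simps)
  then show ?thesis
    using assms by simp
qed

text \<open>
  The Parseval identity for the coefficient sequence \<open>0, 1, \<dots>, r - 1\<close>: after expanding the squared
  norm as a double sum, orthogonality leaves only the diagonal.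
\<close>

lemma parseval_roots_of_unity:
  assumes "r > 0"
  shows "(\<Sum>w | w ^ r = 1. (norm (\<Sum>k<r. of_nat k * w ^ k :: complex))\<^sup>2) = real r * (\<Sum>k<r. (real k)\<^sup>2)"
proof -
  have diag: "w ^ k * cnj (w ^ k) = 1" if "w ^ r = 1" for w :: complex and k
  proof -
    have "norm w = 1"
      using that assms by (metis power_eq_1_iff neq0_conv)
    then show ?thesis
      by (simp only: complex_norm_square[symmetric] norm_power) simp
  qed
  have inner: "(\<Sum>w | w ^ r = 1. w ^ k * cnj (w ^ m)) = (if k = m then of_nat r else (0::complex))"
    if "k < r" "m < r" for k m
  proof (cases "k = m")
    case True
    then have "(\<Sum>w | w ^ r = 1. w ^ k * cnj (w ^ m)) = (\<Sum>w :: complex | w ^ r = 1. 1)"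
      using diag by (intro sum.cong) auto
    then show ?thesis
      using True card_roots_unity_eq[OF assms] by simp
  qed (use roots_of_unity_orthogonal[OF that] in simp)
  have "complex_of_real (\<Sum>w | w ^ r = 1. (norm (\<Sum>k<r. of_nat k * w ^ k :: complex))\<^sup>2)
      = (\<Sum>w | w ^ r = 1. \<Sum>k<r. \<Sum>m<r. (of_nat k * of_nat m) * (w ^ k * cnj (w ^ m)))"
    by (simp add: of_real_sum complex_norm_square sum_product mult_ac del: of_real_power)
  also have "\<dots> = (\<Sum>k<r. \<Sum>m<r. \<Sum>w | w ^ r = 1. (of_nat k * of_nat m) * (w ^ k * cnj (w ^ m)))"
    by (subst sum.swap) (intro sum.cong refl sum.swap)
  also have "\<dots> = (\<Sum>k<r. \<Sum>m<r. (of_nat k * of_nat m) * (if k = m then of_nat r else 0))"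
    unfolding sum_distrib_left[symmetric] by (intro sum.cong refl arg_cong2[where f = "(*)"] inner) auto
  also have "\<dots> = (\<Sum>k<r. \<Sum>m<r. if k = m then of_nat r * (of_nat k)\<^sup>2 else 0)"
    by (intro sum.cong refl) (auto simp: power2_eq_square)
  also have "\<dots> = complex_of_real (real r * (\<Sum>k<r. (real k)\<^sup>2))"
    by (simp add: sum_distrib_left)
  finally show ?thesis
    using of_real_eq_iff by blast
qed

text \<open>
  This is the classical identity \<open>(\<Sum>l=1..r-1. 1 / (sin (\<pi> l / r))\<^sup>2) = (r\<^sup>2 - 1) / 3\<close>, since
  \<open>|1 - e\<^sup>i\<^sup>t|\<^sup>2 = 4 (sin (t / 2))\<^sup>2\<close>. By the Fourier expansion the summand at \<open>w \<noteq> 1\<close> is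
  \<open>|G w|\<^sup>2 / r\<^sup>2\<close> with \<open>G w = (\<Sum>k<r. k w\<^sup>k)\<close>. The sum of \<open>|G w|\<^sup>2\<close> over all roots comes from the
  Parseval identity, and the term \<open>|G 1|\<^sup>2 = (r (r - 1) / 2)\<^sup>2\<close> is subtracted. The root \<open>w = 1\<close>
  itself contributes \<open>1 / 0 = 0\<close> to the sum in the lemma.
\<close>

lemma sum_inverse_dist_roots_of_unity:
  assumes "r > 0"
  shows "(\<Sum>w | w ^ r = 1. 1 / (norm (1 - w :: complex))\<^sup>2) = ((real r)\<^sup>2 - 1) / 12"
proof -
  let ?U = "{w :: complex. w ^ r = 1}"
  let ?G = "\<lambda>w :: complex. \<Sum>k<r. of_nat k * w ^ k"
  have fin: "finite ?U"
    using finite_roots_unity[of r] assms by simp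
  have lin: "(\<Sum>k<n. real k) = real n * (real n - 1) / 2" for n
    by (induction n) (auto simp: field_simps)
  have sq: "(\<Sum>k<n. (real k)\<^sup>2) = real n * (real n - 1) * (2 * real n - 1) / 6" for n
    by (induction n) (auto simp: field_simps power2_eq_square)
  have at_root: "(norm (?G w))\<^sup>2 = (real r)\<^sup>2 * (1 / (norm (1 - w))\<^sup>2)" if "w \<in> ?U - {1}" for w
  proof -
    have w: "w ^ r = 1" "w \<noteq> 1"
      using that by auto
    then have "(\<Sum>k<r. w ^ k) = 0"
      by (simp add: geometric_sum)
    then have "?G w * (1 - w) = - of_nat r"
      using sum_index_power_root_of_unity[OF w(1)] by simp
    then have "norm (?G w) * norm (1 - w) = real r"
      by (metis norm_minus_cancel norm_mult norm_of_nat)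
    then have "(norm (?G w))\<^sup>2 * (norm (1 - w))\<^sup>2 = (real r)\<^sup>2"
      by (metis power_mult_distrib)
    then show ?thesis
      using w by (simp add: field_simps)
  qed
  have one: "(norm (?G 1))\<^sup>2 = (real r * (real r - 1) / 2)\<^sup>2"
  proof -
    have "?G 1 = complex_of_real (\<Sum>k<r. real k)"
      by simp
    then show ?thesis
      by (metis lin norm_of_real power2_abs)
  qed
  have "real r * (\<Sum>k<r. (real k)\<^sup>2) = (norm (?G 1))\<^sup>2 + (\<Sum>w\<in>?U - {1}. (norm (?G w))\<^sup>2)"
    unfolding parseval_roots_of_unity[OF assms, symmetric]
    by (rule sum.remove) (use fin in auto)
  also have "(\<Sum>w\<in>?U - {1}. (norm (?G w))\<^sup>2) = (real r)\<^sup>2 * (\<Sum>w\<in>?U - {1}. 1 / (norm (1 - w))\<^sup>2)"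
    unfolding sum_distrib_left by (rule sum.cong[OF refl at_root])
  also have "(\<Sum>w\<in>?U - {1}. 1 / (norm (1 - w))\<^sup>2) = (\<Sum>w\<in>?U. 1 / (norm (1 - w))\<^sup>2)"
    by (rule sum.mono_neutral_left) (use fin in auto)
  finally have "(real r)\<^sup>2 * (\<Sum>w\<in>?U. 1 / (norm (1 - w))\<^sup>2)
      = (real r)\<^sup>2 * (((real r)\<^sup>2 - 1) / 12)"
    unfolding one sq by (simp add: field_simps power2_eq_square)
  then show ?thesis
    using assms by simp
qed

text \<open>
  Rotating a root \<open>w\<close> to \<open>1\<close> preserves distances and permutes the roots, so all \<open>r\<close> of them have the
  same potential.
\<close>

lemma energy_roots_of_unity:
  assumes "r > 0"
  shows "(\<Sum>l = 1..r. \<Sum>m = 1..r.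
            1 / (norm (cis (2 * pi * real l / real r) - cis (2 * pi * real m / real r)))\<^sup>2)
         = real r * ((real r)\<^sup>2 - 1) / 12"
proof -
  let ?U = "{w :: complex. w ^ r = 1}"
  have "(\<Sum>l = 1..r. \<Sum>m = 1..r.
            1 / (norm (cis (2 * pi * real l / real r) - cis (2 * pi * real m / real r)))\<^sup>2)
        = (\<Sum>w\<in>?U. \<Sum>v\<in>?U. 1 / (norm (w - v))\<^sup>2)"
    by (intro sum.reindex_bij_betw[OF bij_betw_root_of_unity_index[OF assms], THEN trans]
        trans[OF sum.cong[OF refl sum.reindex_bij_betw[OF bij_betw_root_of_unity_index[OF assms]]]] refl)
  also have "\<dots> = (\<Sum>w\<in>?U. \<Sum>v\<in>?U. 1 / (norm (1 - v))\<^sup>2)"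
  proof (rule sum.cong[OF refl])
    fix w assume "w \<in> ?U"
    then have w: "w ^ r = 1" by simp
    then have nw: "norm w = 1"
      using assms by (metis power_eq_1_iff neq0_conv)
    have "(\<Sum>v\<in>?U. 1 / (norm (w - v))\<^sup>2) = (\<Sum>v\<in>?U. 1 / (norm (w - w * v))\<^sup>2)"
      by (rule sum.reindex_bij_betw[symmetric]) (rule bij_betw_mult_roots_of_unity[OF w assms])
    also have "\<dots> = (\<Sum>v\<in>?U. 1 / (norm (1 - v))\<^sup>2)"
    proof (rule sum.cong[OF refl])
      fix v
      have "norm (w - w * v) = norm w * norm (1 - v)"
        by (metis mult.right_neutral norm_mult right_diff_distrib)
      then show "1 / (norm (w - w * v))\<^sup>2 = 1 / (norm (1 - v))\<^sup>2"
        by (simp add: nw)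
    qed
    finally show "(\<Sum>v\<in>?U. 1 / (norm (w - v))\<^sup>2) = (\<Sum>v\<in>?U. 1 / (norm (1 - v))\<^sup>2)" .
  qed
  also have "\<dots> = real r * ((real r)\<^sup>2 - 1) / 12"
    using sum_inverse_dist_roots_of_unity[OF assms] card_roots_unity_eq[OF assms] by simp
  finally show ?thesis .
qed

section \<open>The mean energy of two randomly rotated points\<close>

lemma diff_le_diff_mult_cos:
  fixes a b x :: real
  assumes "0 \<le> b"
  shows "a - b \<le> a - b * cos x"
  using mult_left_mono[OF cos_le_one assms, of x] by simp

text \<open>
  The integrand is a Poisson kernel: with \<open>s = sqrt (a\<^sup>2 - b\<^sup>2)\<close> and \<open>q = b / (a + s)\<close>, the root in
  \<open>(0, 1)\<close> of \<open>b q\<^sup>2 - 2 a q + b = 0\<close>, it equals \<open>(1 - q\<^sup>2) / (s (1 - 2 q cos x + q\<^sup>2))\<close>. The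
  Fourier series \<open>1 + 2 (\<Sum>n\<ge>1. q\<^sup>n cos (n x))\<close> of the kernel without the factor \<open>1 / s\<close> integrates
  termwise to \<open>x + 2 arctan (q sin x / (1 - q cos x))\<close>. Unlike the antiderivative obtained from the
  substitution \<open>tan (x / 2)\<close>, this one is smooth on the whole line, so the fundamental theorem applies
  to a period starting anywhere, and only the term \<open>x / s\<close> changes over it.
\<close>

lemma integral_inverse_cos_over_period:
  fixes a b c :: real
  assumes "0 < b" "b < a"
  shows "(\<integral>x. 1 / (a - b * cos (x + c)) * indicator {0..2 * pi} x \<partial>lborel)
         = 2 * pi / sqrt (a\<^sup>2 - b\<^sup>2)"
proof -
  define s where "s = sqrt (a\<^sup>2 - b\<^sup>2)"
  define q where "q = b / (a + s)"
  have ab: "a\<^sup>2 - b\<^sup>2 > 0"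
    using assms by (simp add: power_strict_mono)
  then have s: "s > 0" and s2: "s\<^sup>2 = a\<^sup>2 - b\<^sup>2"
    by (auto simp: s_def)
  have q: "0 < q" "q < 1"
    using assms s by (auto simp: q_def)
  have as: "a + s > 0" using assms s by simp
  have qb: "b = q * (a + s)"
    using as by (simp add: q_def)
  have qa: "b * (1 + q\<^sup>2) = 2 * a * q"
  proof -
    have "b * ((a + s)\<^sup>2 + b\<^sup>2) = 2 * a * b * (a + s)"
      using s2 by algebra
    then have "(a + s)\<^sup>2 * (b * (1 + q\<^sup>2)) = (a + s)\<^sup>2 * (2 * a * q)"
      using qb by algebra
    then show ?thesis
      using as by simp
  qed
  have qs: "b * (1 - q\<^sup>2) = 2 * s * q"
  proof -
    have "b * ((a + s)\<^sup>2 - b\<^sup>2) = 2 * s * b * (a + s)"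
      using s2 by algebra
    then have "(a + s)\<^sup>2 * (b * (1 - q\<^sup>2)) = (a + s)\<^sup>2 * (2 * s * q)"
      using qb by algebra
    then show ?thesis
      using as by simp
  qed
  define F where "F x = (x + 2 * arctan (q * sin x / (1 - q * cos x))) / s" for x
  have deriv: "(F has_real_derivative 1 / (a - b * cos x)) (at x)" for x
  proof -
    have qc: "1 - q * cos x > 0"
      using q diff_le_diff_mult_cos[of q 1 x] by linarith
    have pos: "a - b * cos x > 0"
      using assms diff_le_diff_mult_cos[of b a x] by linarith
    let ?P = "1 - q * cos x"
    have sc: "(sin x)\<^sup>2 = 1 - (cos x)\<^sup>2"
      by (simp add: sin_squared_eq)
    have "(F has_real_derivative
        (1 + 2 * (inverse (1 + (q * sin x / ?P)\<^sup>2) *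
            ((q * cos x * ?P - q * sin x * (q * sin x)) / (?P * ?P)))) / s) (at x)"
      unfolding F_def using qc s
      by (auto intro!: derivative_eq_intros simp: power2_eq_square)
    moreover have "(1 + 2 * (inverse (1 + (q * sin x / ?P)\<^sup>2) *
            ((q * cos x * ?P - q * sin x * (q * sin x)) / (?P * ?P)))) / s = 1 / (a - b * cos x)"
    proof -
      have D: "1 + q\<^sup>2 - 2 * q * cos x > 0"
      proof -
        have "1 + q\<^sup>2 - 2 * q * cos x = 2 * q / b * (a - b * cos x)"
          using qa assms by (simp add: field_simps)
        then show ?thesis using q assms pos by simp
      qed
      have e1: "1 + (q * sin x / ?P)\<^sup>2 = (1 + q\<^sup>2 - 2 * q * cos x) / ?P\<^sup>2"
      proof -
        have "?P\<^sup>2 + (q * sin x)\<^sup>2 = 1 + q\<^sup>2 - 2 * q * cos x"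
          using sc by algebra
        moreover have "1 + (q * sin x / ?P)\<^sup>2 = (?P\<^sup>2 + (q * sin x)\<^sup>2) / ?P\<^sup>2"
          using qc by (simp add: power_divide add_divide_distrib)
        ultimately show ?thesis by simp
      qed
      have e2: "q * cos x * ?P - q * sin x * (q * sin x) = q * cos x - q\<^sup>2"
        using sc by algebra
      have "inverse (1 + (q * sin x / ?P)\<^sup>2) *
            ((q * cos x * ?P - q * sin x * (q * sin x)) / (?P * ?P))
          = (q * cos x - q\<^sup>2) / (1 + q\<^sup>2 - 2 * q * cos x)"
        unfolding e1 e2 using qc D by (simp add: power2_eq_square)
      also have "1 + 2 * \<dots> = (1 - q\<^sup>2) / (1 + q\<^sup>2 - 2 * q * cos x)"
        using D by (simp add: field_simps)
      also have "\<dots> = s / (a - b * cos x)"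
      proof -
        have "b * ((1 - q\<^sup>2) * (a - b * cos x)) = b * (s * (1 + q\<^sup>2 - 2 * q * cos x))"
          using qa qs by algebra
        then have "(1 - q\<^sup>2) * (a - b * cos x) = s * (1 + q\<^sup>2 - 2 * q * cos x)"
          using assms by simp
        then show ?thesis
          using D pos by (simp add: frac_eq_eq)
      qed
      finally show ?thesis using s by simp
    qed
    ultimately show ?thesis by simp
  qed
  have "(\<integral>x. 1 / (a - b * cos (x + c)) * indicator {0..2 * pi} x \<partial>lborel)
      = F (2 * pi + c) - F (0 + c)"
  proof (rule integral_FTC_Icc_real)
    fix x
    show "((\<lambda>x. F (x + c)) has_real_derivative 1 / (a - b * cos (x + c))) (at x)"
      using deriv[of "x + c"] by (simp add: DERIV_shift)
    have "a - b * cos (x + c) \<noteq> 0"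
      using assms diff_le_diff_mult_cos[of b a "x + c"] by linarith
    then show "isCont (\<lambda>x. 1 / (a - b * cos (x + c))) x"
      by (intro continuous_intros) auto
  qed simp
  also have "\<dots> = 2 * pi / s"
    by (simp add: F_def sin_add cos_add diff_divide_distrib[symmetric])
  finally show ?thesis
    by (simp add: s_def)
qed

lemma integral_uniform_measure_Icc:
  fixes f :: "real \<Rightarrow> real"
  assumes [measurable]: "f \<in> borel_measurable borel" and "u < v"
  shows "(\<integral>x. f x \<partial>uniform_measure lborel {u..v}) = (\<integral>x. f x * indicator {u..v} x \<partial>lborel) / (v - u)"
proof -
  have "uniform_measure lborel {u..v} = density lborel (\<lambda>x. ennreal (indicator {u..v} x / (v - u)))"
    unfolding uniform_measure_def using assms(2)
    by (intro density_cong) (auto simp: divide_ennreal[symmetric] ennreal_indicator)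
  then have "(\<integral>x. f x \<partial>uniform_measure lborel {u..v})
      = (\<integral>x. indicator {u..v} x / (v - u) * f x \<partial>lborel)"
    using assms(2) by (simp add: integral_real_density)
  also have "\<dots> = (\<integral>x. (f x * indicator {u..v} x) / (v - u) \<partial>lborel)"
    by (simp add: mult_ac)
  finally show ?thesis by simp
qed

lemma (in prob_space) indep_vars_imp_indep_var:
  assumes "indep_vars (\<lambda>_. N) X I" "j \<in> I" "k \<in> I" "j \<noteq> k"
  shows "indep_var N (X j) N (X k)"
proof -
  have "indep_var (PiM {j} (\<lambda>_. N)) (\<lambda>\<omega>. \<lambda>i\<in>{j}. X i \<omega>) (PiM {k} (\<lambda>_. N)) (\<lambda>\<omega>. \<lambda>i\<in>{k}. X i \<omega>)"
    by (rule indep_var_restrict[OF assms(1)]) (use assms in auto)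
  from indep_var_compose[OF this, of "\<lambda>f. f j" N "\<lambda>f. f k" N]
  show ?thesis
    by (simp add: o_def measurable_component_singleton)
qed

text \<open>
  For every fixed value of \<open>Y\<close>, the uniform variable \<open>X\<close> averages the integrand over a full period,
  and every phase shift \<open>c - Y\<close> gives the same mean.
\<close>

lemma (in prob_space) expectation_inverse_cos_difference:
  fixes X Y :: "'a \<Rightarrow> real" and a b c :: real
  assumes indep: "indep_var borel X borel Y"
    and unif: "distr M borel X = uniform_measure lborel {0..2 * pi}"
    and ab: "0 < b" "b < a"
  shows "integrable M (\<lambda>\<xi>. 1 / (a - b * cos (X \<xi> - Y \<xi> + c)))"
    and "expectation (\<lambda>\<xi>. 1 / (a - b * cos (X \<xi> - Y \<xi> + c))) = 1 / sqrt (a\<^sup>2 - b\<^sup>2)"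
proof -
  have [measurable]: "X \<in> borel_measurable M" "Y \<in> borel_measurable M"
    using indep indep_var_rv1 indep_var_rv2 by blast+
  let ?f = "\<lambda>(x, y). 1 / (a - b * cos (x - y + c))"
  have bound: "\<bar>1 / (a - b * cos t)\<bar> \<le> 1 / (a - b)" for t
  proof -
    have "a - b \<le> a - b * cos t"
      using ab diff_le_diff_mult_cos[of b a t] by linarith
    moreover from this have "0 < a - b * cos t"
      using ab by linarith
    ultimately show ?thesis
      using ab by (simp add: frac_le)
  qed
  show "integrable M (\<lambda>\<xi>. 1 / (a - b * cos (X \<xi> - Y \<xi> + c)))"
    by (rule integrable_const_bound[where B = "1 / (a - b)"]) (use bound in auto)
  let ?D = "distr M borel X" and ?E = "distr M borel Y"
  interpret D: prob_space ?D by (rule prob_space_distr) simp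
  interpret E: prob_space ?E by (rule prob_space_distr) simp
  interpret P: pair_prob_space ?D ?E ..
  have joint: "distr M (borel \<Otimes>\<^sub>M borel) (\<lambda>\<xi>. (X \<xi>, Y \<xi>)) = ?D \<Otimes>\<^sub>M ?E"
    using indep by (simp add: indep_var_distribution_eq)
  have int: "integrable (?D \<Otimes>\<^sub>M ?E) ?f"
    by (rule P.integrable_const_bound[where B = "1 / (a - b)"]) (use bound in auto)
  have "expectation (\<lambda>\<xi>. 1 / (a - b * cos (X \<xi> - Y \<xi> + c)))
      = (\<integral>t. ?f t \<partial>distr M (borel \<Otimes>\<^sub>M borel) (\<lambda>\<xi>. (X \<xi>, Y \<xi>)))"
    by (subst integral_distr) auto
  also have "\<dots> = (\<integral>y. \<integral>x. ?f (x, y) \<partial>?D \<partial>?E)"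
    unfolding joint using P.integral_snd[of "\<lambda>x y. ?f (x, y)"] int by (simp add: case_prod_unfold)
  also have "\<dots> = (\<integral>y. 1 / sqrt (a\<^sup>2 - b\<^sup>2) \<partial>?E)"
  proof (rule Bochner_Integration.integral_cong[OF refl])
    fix y
    have "(\<integral>x. ?f (x, y) \<partial>?D)
        = (\<integral>x. 1 / (a - b * cos (x + (c - y))) * indicator {0..2 * pi} x \<partial>lborel) / (2 * pi - 0)"
      unfolding unif by (subst integral_uniform_measure_Icc) (auto simp: algebra_simps)
    then show "(\<integral>x. ?f (x, y) \<partial>?D) = 1 / sqrt (a\<^sup>2 - b\<^sup>2)"
      unfolding integral_inverse_cos_over_period[OF ab] by simp
  qed
  also have "\<dots> = 1 / sqrt (a\<^sup>2 - b\<^sup>2)"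
    using E.prob_space by simp
  finally show "expectation (\<lambda>\<xi>. 1 / (a - b * cos (X \<xi> - Y \<xi> + c))) = 1 / sqrt (a\<^sup>2 - b\<^sup>2)" .
qed

section \<open>Distances in the configuration\<close>

text \<open>
  A diagonal term is \<open>1 / 0 = 0\<close>, so the condition \<open>x \<noteq> y\<close> can be dropped and the sum can be split over
  the pieces of a configuration.
\<close>

lemma energy2_eq_double_sum:
  assumes "finite \<omega>"
  shows "energy2 \<omega> = (\<Sum>x\<in>\<omega>. \<Sum>y\<in>\<omega>. 1 / (norm (x - y))\<^sup>2)"
proof -
  have "energy2 \<omega> = (\<Sum>(x, y)\<in>\<omega> \<times> \<omega>. 1 / (norm (x - y))\<^sup>2)"
    unfolding energy2_def
    by (rule sum.mono_neutral_left) (use assms in auto)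
  then show ?thesis
    by (simp add: sum.cartesian_product)
qed

lemma norm_vector_3_diff:
  "(norm (vector [a, b, c] - vector [a', b', c'] :: real ^ 3))\<^sup>2
     = (a - a')\<^sup>2 + (b - b')\<^sup>2 + (c - c')\<^sup>2"
  by (simp only: power2_norm_eq_inner) (simp add: inner_vec_def sum_3 power2_eq_square)

lemma norm_parallel_point_diff:
  assumes "z \<in> {-1<..<1}" "z' \<in> {-1<..<1}"
  shows "(norm (parallel_point r z \<phi> l - parallel_point r' z' \<phi>' l'))\<^sup>2
     = (2 - 2 * z * z') - 2 * sqrt (1 - z\<^sup>2) * sqrt (1 - z'\<^sup>2)
         * cos (\<phi> - \<phi>' + (2 * pi * real l / real r - 2 * pi * real l' / real r'))"
proof -
  define A where "A = 2 * pi * real l / real r + \<phi>"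
  define B where "B = 2 * pi * real l' / real r' + \<phi>'"
  define \<rho> where "\<rho> = sqrt (1 - z\<^sup>2)"
  define \<sigma> where "\<sigma> = sqrt (1 - z'\<^sup>2)"
  have sq: "\<rho>\<^sup>2 = 1 - z\<^sup>2" "\<sigma>\<^sup>2 = 1 - z'\<^sup>2"
    using assms by (auto simp: \<rho>_def \<sigma>_def abs_square_le_1)
  have trig: "(sin A)\<^sup>2 = 1 - (cos A)\<^sup>2" "(sin B)\<^sup>2 = 1 - (cos B)\<^sup>2"
    by (simp_all add: sin_squared_eq)
  have "(norm (parallel_point r z \<phi> l - parallel_point r' z' \<phi>' l'))\<^sup>2
      = (\<rho> * cos A - \<sigma> * cos B)\<^sup>2 + (\<rho> * sin A - \<sigma> * sin B)\<^sup>2 + (z - z')\<^sup>2"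
    unfolding parallel_point_def norm_vector_3_diff by (simp add: A_def B_def \<rho>_def \<sigma>_def)
  also have "\<dots> = (2 - 2 * z * z') - 2 * \<rho> * \<sigma> * (cos A * cos B + sin A * sin B)"
    using sq trig by algebra
  also have "cos A * cos B + sin A * sin B = cos (A - B)"
    by (simp add: cos_diff)
  also have "A - B = \<phi> - \<phi>' + (2 * pi * real l / real r - 2 * pi * real l' / real r')"
    by (simp add: A_def B_def)
  finally show ?thesis
    by (simp add: \<rho>_def \<sigma>_def)
qed

lemma norm_same_parallel_diff:
  assumes "z \<in> {-1<..<1}"
  shows "(norm (parallel_point r z \<phi> l - parallel_point r z \<phi> m))\<^sup>2
     = (1 - z\<^sup>2) * (norm (cis (2 * pi * real l / real r) - cis (2 * pi * real m / real r)))\<^sup>2"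
proof -
  define A where "A = 2 * pi * real l / real r"
  define B where "B = 2 * pi * real m / real r"
  have trig: "(sin A)\<^sup>2 = 1 - (cos A)\<^sup>2" "(sin B)\<^sup>2 = 1 - (cos B)\<^sup>2"
    by (simp_all add: sin_squared_eq)
  have "(norm (cis A - cis B))\<^sup>2 = (cos A - cos B)\<^sup>2 + (sin A - sin B)\<^sup>2"
    by (simp add: cmod_power2)
  also have "\<dots> = 2 - 2 * cos (A - B)"
    unfolding cos_diff using trig by algebra
  finally have cis: "(norm (cis A - cis B))\<^sup>2 = 2 - 2 * cos (A - B)" .
  have "sqrt (1 - z\<^sup>2) * sqrt (1 - z\<^sup>2) = 1 - z\<^sup>2"
    using assms by (auto simp: abs_square_le_1)
  then have "(norm (parallel_point r z \<phi> l - parallel_point r z \<phi> m))\<^sup>2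
      = (2 - 2 * z * z) - 2 * (1 - z\<^sup>2) * cos (A - B)"
    unfolding norm_parallel_point_diff[OF assms assms] A_def B_def by (simp add: mult.assoc)
  also have "\<dots> = (1 - z\<^sup>2) * (norm (cis A - cis B))\<^sup>2"
    unfolding cis by (simp add: algebra_simps power2_eq_square)
  finally show ?thesis
    by (simp only: A_def B_def)
qed

lemma norm_pole_parallel_point_diff:
  assumes "z \<in> {-1<..<1}"
  shows "(norm (vector [0, 0, 1] - parallel_point r z \<phi> l))\<^sup>2 = 2 - 2 * z"
    and "(norm (vector [0, 0, -1] - parallel_point r z \<phi> l))\<^sup>2 = 2 + 2 * z"
proof -
  define A where "A = 2 * pi * real l / real r + \<phi>"
  define \<rho> where "\<rho> = sqrt (1 - z\<^sup>2)"
  have sq: "\<rho>\<^sup>2 = 1 - z\<^sup>2"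
    using assms by (auto simp: \<rho>_def abs_square_le_1)
  have trig: "(sin A)\<^sup>2 = 1 - (cos A)\<^sup>2"
    by (simp add: sin_squared_eq)
  have "(norm (vector [0, 0, 1] - parallel_point r z \<phi> l))\<^sup>2
      = (\<rho> * cos A)\<^sup>2 + (\<rho> * sin A)\<^sup>2 + (1 - z)\<^sup>2"
    unfolding parallel_point_def norm_vector_3_diff by (simp add: A_def \<rho>_def)
  also have "\<dots> = 2 - 2 * z"
    using sq trig by algebra
  finally show "(norm (vector [0, 0, 1] - parallel_point r z \<phi> l))\<^sup>2 = 2 - 2 * z" .
  have "(norm (vector [0, 0, -1] - parallel_point r z \<phi> l))\<^sup>2
      = (\<rho> * cos A)\<^sup>2 + (\<rho> * sin A)\<^sup>2 + (- 1 - z)\<^sup>2"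
    unfolding parallel_point_def norm_vector_3_diff by (simp add: A_def \<rho>_def)
  also have "\<dots> = 2 + 2 * z"
    using sq trig by algebra
  finally show "(norm (vector [0, 0, -1] - parallel_point r z \<phi> l))\<^sup>2 = 2 + 2 * z" .
qed

lemma energy_parallel:
  assumes "z \<in> {-1<..<1}" "r > 0"
  shows "(\<Sum>l = 1..r. \<Sum>m = 1..r. 1 / (norm (parallel_point r z \<phi> l - parallel_point r z \<phi> m))\<^sup>2)
     = real r * ((real r)\<^sup>2 - 1) / (12 * (1 - z\<^sup>2))"
proof -
  have "(\<Sum>l = 1..r. \<Sum>m = 1..r. 1 / (norm (parallel_point r z \<phi> l - parallel_point r z \<phi> m))\<^sup>2)
      = (\<Sum>l = 1..r. \<Sum>m = 1..r.
          1 / (norm (cis (2 * pi * real l / real r) - cis (2 * pi * real m / real r)))\<^sup>2) / (1 - z\<^sup>2)"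
    unfolding norm_same_parallel_diff[OF assms(1)] sum_divide_distrib by (simp add: mult.commute)
  then show ?thesis
    unfolding energy_roots_of_unity[OF assms(2)] by (simp add: mult.commute)
qed

text \<open>
  The third coordinate determines the parallel, and within a parallel distances are proportional to
  those of distinct roots of unity. Hence sums over the set of points are sums over indices.
\<close>

lemma inj_on_parallel_points:
  assumes "\<And>j. j \<in> J \<Longrightarrow> r j > 0" "\<And>j. j \<in> J \<Longrightarrow> z j \<in> {-1<..<1}" "inj_on z J"
  shows "inj_on (\<lambda>(j, l). parallel_point (r j) (z j) (\<phi> j) l) (SIGMA j:J. {1..r j})"
proof (rule inj_onI, clarify)
  fix j l k m
  assume jk: "j \<in> J" "k \<in> J" and lm: "l \<in> {1..r j}" "m \<in> {1..r k}"
    and eq: "parallel_point (r j) (z j) (\<phi> j) l = parallel_point (r k) (z k) (\<phi> k) m"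
  have "z j = z k"
    using arg_cong[OF eq, of "\<lambda>x. x $ 3"] by (simp add: parallel_point_def)
  then have "j = k"
    using assms(3) jk by (auto dest: inj_onD)
  have "1 - (z j)\<^sup>2 \<noteq> 0"
    using assms(2)[OF jk(1)] by (auto simp: power2_eq_1_iff)
  moreover have "(1 - (z j)\<^sup>2) *
      (norm (cis (2 * pi * real l / real (r j)) - cis (2 * pi * real m / real (r j))))\<^sup>2 = 0"
    using norm_same_parallel_diff[OF assms(2)[OF jk(1)], of "r j" "\<phi> j" l m] eq \<open>j = k\<close> by simp
  ultimately have "cis (2 * pi * real l / real (r j)) = cis (2 * pi * real m / real (r j))"
    by simp
  then have "l = m"
    using bij_betw_root_of_unity_index[OF assms(1)[OF jk(1)]] lm \<open>j = k\<close>
    by (auto simp: bij_betw_def dest: inj_onD)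
  with \<open>j = k\<close> show "j = k \<and> l = m" by simp
qed

section \<open>The energy of the configuration\<close>

lemma sum_square_split_diagonal:
  fixes g :: "'i \<Rightarrow> 'i \<Rightarrow> 'b :: comm_monoid_add"
  assumes "finite J"
  shows "(\<Sum>j\<in>J. \<Sum>k\<in>J. g j k)
      = (\<Sum>j\<in>J. g j j) + (\<Sum>(j, k) \<in> {(j, k). j \<in> J \<and> k \<in> J \<and> j \<noteq> k}. g j k)"
proof -
  let ?O = "{(j, k). j \<in> J \<and> k \<in> J \<and> j \<noteq> k}"
  have "(\<Sum>j\<in>J. \<Sum>k\<in>J. g j k) = (\<Sum>(j, k)\<in>(\<lambda>j. (j, j)) ` J \<union> ?O. g j k)"
    unfolding sum.cartesian_product by (rule sum.cong) auto
  also have "\<dots> = (\<Sum>(j, k)\<in>(\<lambda>j. (j, j)) ` J. g j k) + (\<Sum>(j, k)\<in>?O. g j k)"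
    by (rule sum.union_disjoint) (use assms in \<open>auto intro: finite_subset[of _ "J \<times> J"]\<close>)
  also have "(\<Sum>(j, k)\<in>(\<lambda>j. (j, j)) ` J. g j k) = (\<Sum>j\<in>J. g j j)"
    by (subst sum.reindex) (auto simp: inj_on_def)
  finally show ?thesis .
qed

text \<open>
  The opposite poles contribute two ordered pairs at distance \<open>2\<close>. A point at height \<open>z\<close> interacts
  with the two poles through \<open>1 / (2 - 2 z) + 1 / (2 + 2 z) = 1 / (1 - z\<^sup>2)\<close>, and every such pair is
  counted in both orders. The remaining terms are the pairs of points on parallels, of which those on
  one common parallel have an energy independent of its phase.
\<close>

lemma energy2_parallel_config:
  assumes r: "\<And>j. j \<in> {1..p} \<Longrightarrow> r j > 0"
    and z: "\<And>j. j \<in> {1..p} \<Longrightarrow> z j \<in> {-1<..<1}"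
    and inj: "inj_on z {1..p}"
  shows "energy2 (parallel_config p r z \<phi>) =
      1 / 2 + (\<Sum>j = 1..p. 2 * real (r j) / (1 - (z j)\<^sup>2))
      + (\<Sum>j = 1..p. real (r j) * ((real (r j))\<^sup>2 - 1) / (12 * (1 - (z j)\<^sup>2)))
      + (\<Sum>(j, k) \<in> {(j, k). j \<in> {1..p} \<and> k \<in> {1..p} \<and> j \<noteq> k}. \<Sum>l = 1..r j. \<Sum>m = 1..r k.
          1 / (norm (parallel_point (r j) (z j) (\<phi> j) l - parallel_point (r k) (z k) (\<phi> k) m))\<^sup>2)"
proof -
  let ?N = "vector [0, 0, 1] :: real ^ 3" and ?S = "vector [0, 0, -1] :: real ^ 3"
  let ?h = "\<lambda>x y :: real ^ 3. 1 / (norm (x - y))\<^sup>2"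
  let ?P = "\<lambda>j l. parallel_point (r j) (z j) (\<phi> j) l"
  let ?I = "SIGMA j:{1..p}. {1..r j}"
  let ?O = "{(j, k). j \<in> {1..p} \<and> k \<in> {1..p} \<and> j \<noteq> k}"
  define Q where "Q = (\<lambda>(j, l). ?P j l) ` ?I"
  have config: "parallel_config p r z \<phi> = insert ?N (insert ?S Q)"
    unfolding parallel_config_def Q_def by (auto simp: image_iff) blast+
  have finQ: "finite Q"
    by (simp add: Q_def)
  have sumQ: "(\<Sum>x\<in>Q. g x) = (\<Sum>j = 1..p. \<Sum>l = 1..r j. g (?P j l))" for g :: "real ^ 3 \<Rightarrow> real"
    unfolding Q_def
    by (subst sum.reindex[OF inj_on_parallel_points[OF r z inj]])
       (auto simp: sum.Sigma case_prod_unfold intro!: sum.cong)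
  have NS: "(norm (?N - ?S))\<^sup>2 = 4" "(norm (?S - ?N))\<^sup>2 = 4" "?N \<noteq> ?S"
    by (auto simp: power2_norm_eq_inner inner_vec_def sum_3 vec_eq_iff forall_3)
  have notin: "?N \<notin> Q" "?S \<notin> Q"
    using z by (force simp: Q_def parallel_point_def vec_eq_iff forall_3)+
  have pole: "?h ?N (?P j l) + ?h ?S (?P j l) = 1 / (1 - (z j)\<^sup>2)" if "j \<in> {1..p}" for j l
  proof -
    have "1 - z j > 0" "1 + z j > 0"
      using z[OF that] by auto
    moreover from this have "1 - (z j)\<^sup>2 = (1 - z j) * (1 + z j)"
      by (simp add: power2_eq_square algebra_simps)
    ultimately show ?thesis
      unfolding norm_pole_parallel_point_diff[OF z[OF that]]
      by (simp add: divide_simps) (simp add: algebra_simps)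
  qed
  have poles: "(\<Sum>x\<in>Q. ?h ?N x) + (\<Sum>x\<in>Q. ?h ?S x) = (\<Sum>j = 1..p. real (r j) / (1 - (z j)\<^sup>2))"
    unfolding sumQ sum.distrib[symmetric] by (rule sum.cong[OF refl]) (simp add: pole)
  have poles': "(\<Sum>x\<in>Q. ?h x ?N) + (\<Sum>x\<in>Q. ?h x ?S) = (\<Sum>j = 1..p. real (r j) / (1 - (z j)\<^sup>2))"
    using poles by (simp add: norm_minus_commute)
  have "energy2 (parallel_config p r z \<phi>) = 1 / 2
      + ((\<Sum>x\<in>Q. ?h ?N x) + (\<Sum>x\<in>Q. ?h ?S x)) + ((\<Sum>x\<in>Q. ?h x ?N) + (\<Sum>x\<in>Q. ?h x ?S))
      + (\<Sum>x\<in>Q. \<Sum>y\<in>Q. ?h x y)"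
    unfolding config using finQ notin NS
    by (subst energy2_eq_double_sum) (simp_all add: sum.distrib)
  also have "(\<Sum>x\<in>Q. \<Sum>y\<in>Q. ?h x y)
      = (\<Sum>j = 1..p. \<Sum>k = 1..p. \<Sum>l = 1..r j. \<Sum>m = 1..r k. ?h (?P j l) (?P k m))"
    unfolding sumQ by (intro sum.cong refl sum.swap)
  also have "\<dots> = (\<Sum>j = 1..p. \<Sum>l = 1..r j. \<Sum>m = 1..r j. ?h (?P j l) (?P j m))
      + (\<Sum>(j, k)\<in>?O. \<Sum>l = 1..r j. \<Sum>m = 1..r k. ?h (?P j l) (?P k m))"
    by (rule sum_square_split_diagonal) simp
  also have "(\<Sum>j = 1..p. \<Sum>l = 1..r j. \<Sum>m = 1..r j. ?h (?P j l) (?P j m))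
      = (\<Sum>j = 1..p. real (r j) * ((real (r j))\<^sup>2 - 1) / (12 * (1 - (z j)\<^sup>2)))"
    by (intro sum.cong refl energy_parallel z r)
  moreover have "(\<Sum>j = 1..p. 2 * real (r j) / (1 - (z j)\<^sup>2))
      = (\<Sum>j = 1..p. real (r j) / (1 - (z j)\<^sup>2)) + (\<Sum>j = 1..p. real (r j) / (1 - (z j)\<^sup>2))"
    unfolding sum.distrib[symmetric] by (simp add: add_divide_distrib[symmetric])
  ultimately show ?thesis
    unfolding poles poles' by linarith
qed

text \<open>
  The squared distance is \<open>a - b cos (X - Y + c)\<close> with \<open>a = 2 - 2 z z'\<close> and
  \<open>b = 2 sqrt ((1 - z\<^sup>2) (1 - z'\<^sup>2))\<close>. The mean depends on the heights only through their difference
  because \<open>a\<^sup>2 - b\<^sup>2 = (2 (z - z'))\<^sup>2\<close>.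
\<close>

lemma (in prob_space) expectation_inverse_norm_parallel_points:
  assumes z: "z \<in> {-1<..<1}" "z' \<in> {-1<..<1}" "z \<noteq> z'"
    and indep: "indep_var borel X borel Y"
    and unif: "distr M borel X = uniform_measure lborel {0..2 * pi}"
  shows "integrable M (\<lambda>\<xi>. 1 / (norm (parallel_point r z (X \<xi>) l - parallel_point r' z' (Y \<xi>) l'))\<^sup>2)"
    and "expectation (\<lambda>\<xi>. 1 / (norm (parallel_point r z (X \<xi>) l - parallel_point r' z' (Y \<xi>) l'))\<^sup>2)
      = 1 / (2 * \<bar>z - z'\<bar>)"
proof -
  define a where "a = 2 - 2 * z * z'"
  define b where "b = 2 * sqrt (1 - z\<^sup>2) * sqrt (1 - z'\<^sup>2)"
  have sq1: "z\<^sup>2 < 1" "z'\<^sup>2 < 1"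
    using z by (auto simp: abs_square_less_1)
  have "b\<^sup>2 = 4 * (1 - z\<^sup>2) * (1 - z'\<^sup>2)"
    using sq1 by (simp add: b_def power_mult_distrib)
  then have ab: "a\<^sup>2 - b\<^sup>2 = (2 * (z - z'))\<^sup>2"
    unfolding a_def by algebra
  have b: "b > 0"
    using sq1 by (simp add: b_def)
  have "2 * (z * z') \<le> z\<^sup>2 + z'\<^sup>2"
    using sum_squares_bound[of z z'] by (simp add: mult.assoc)
  then have "a > 0"
    using sq1 by (simp add: a_def)
  moreover have "b\<^sup>2 < a\<^sup>2"
    using ab z(3) by (metis diff_gt_0_iff_gt eq_iff_diff_eq_0 mult_eq_0_iff zero_less_power2 zero_neq_numeral)
  ultimately have "b < a"
    by (simp add: power_less_imp_less_base)
  note cos_integral = expectation_inverse_cos_difference[OF indep unif b this,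
      of "2 * pi * real l / real r - 2 * pi * real l' / real r'"]
  have "sqrt (a\<^sup>2 - b\<^sup>2) = 2 * \<bar>z - z'\<bar>"
    unfolding ab real_sqrt_abs by (simp only: abs_mult abs_numeral)
  then show "integrable M (\<lambda>\<xi>. 1 / (norm (parallel_point r z (X \<xi>) l - parallel_point r' z' (Y \<xi>) l'))\<^sup>2)"
    and "expectation (\<lambda>\<xi>. 1 / (norm (parallel_point r z (X \<xi>) l - parallel_point r' z' (Y \<xi>) l'))\<^sup>2)
      = 1 / (2 * \<bar>z - z'\<bar>)"
    unfolding norm_parallel_point_diff[OF z(1,2)] using cos_integral by (simp_all add: a_def b_def)
qed

theorem proposition2p2:
  fixes M :: "'a measure" and \<theta> :: "nat \<Rightarrow> 'a \<Rightarrow> real"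
    and p :: nat and r :: "nat \<Rightarrow> nat" and z :: "nat \<Rightarrow> real"
  assumes "p \<ge> 1"
    and "\<And>j. j \<in> {1..p} \<Longrightarrow> r j > 0"
    and "\<And>j. j \<in> {1..p} \<Longrightarrow> z j \<in> {-1<..<1}"
    and "inj_on z {1..p}"
    and "prob_space M"
    and "prob_space.indep_vars M (\<lambda>_. borel) \<theta> {1..p}"
    and "\<And>j. j \<in> {1..p} \<Longrightarrow> distr M borel (\<theta> j) = uniform_measure lborel {0..2 * pi}"
  shows "prob_space.expectation M (\<lambda>\<xi>. energy2 (parallel_config p r z (\<lambda>j. \<theta> j \<xi>))) =
           1 / 2
           + 23 / 12 * (\<Sum>j = 1..p. real (r j) / (1 - (z j)\<^sup>2))
           + 1 / 12 * (\<Sum>j = 1..p. real (r j) ^ 3 / (1 - (z j)\<^sup>2))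
           + 1 / 2 * (\<Sum>(j, k) \<in> {(j, k). j \<in> {1..p} \<and> k \<in> {1..p} \<and> j \<noteq> k}.
                        real (r j) * real (r k) / \<bar>z j - z k\<bar>)"
proof -
  interpret prob_space M by fact
  let ?O = "{(j, k). j \<in> {1..p} \<and> k \<in> {1..p} \<and> j \<noteq> k}"
  let ?c = "\<lambda>j. 1 - (z j)\<^sup>2"
  let ?P = "\<lambda>j l \<xi>. parallel_point (r j) (z j) (\<theta> j \<xi>) l"
  let ?C = "1 / 2 + (\<Sum>j = 1..p. 2 * real (r j) / ?c j)
      + (\<Sum>j = 1..p. real (r j) * ((real (r j))\<^sup>2 - 1) / (12 * ?c j))"
  let ?G = "\<lambda>j k \<xi>. \<Sum>l = 1..r j. \<Sum>m = 1..r k. 1 / (norm (?P j l \<xi> - ?P k m \<xi>))\<^sup>2"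
  \<comment> \<open>The contributions of the poles and of each parallel with itself, which do not depend on the
    phases, are collected in \<open>?C\<close>; only the mutual energies \<open>?G j k\<close> are random.\<close>
  have pair: "integrable M (\<lambda>\<xi>. 1 / (norm (?P j l \<xi> - ?P k m \<xi>))\<^sup>2)"
    "expectation (\<lambda>\<xi>. 1 / (norm (?P j l \<xi> - ?P k m \<xi>))\<^sup>2) = 1 / (2 * \<bar>z j - z k\<bar>)"
    if "(j, k) \<in> ?O" for j k l m
  proof -
    have jk: "j \<in> {1..p}" "k \<in> {1..p}" "j \<noteq> k"
      using that by auto
    have "z j \<noteq> z k"
      using assms(4) jk by (auto dest: inj_onD)
    note expectation_inverse_norm_parallel_points[OF assms(3)[OF jk(1)] assms(3)[OF jk(2)] this
        indep_vars_imp_indep_var[OF assms(6) jk] assms(7)[OF jk(1)]]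
    then show "integrable M (\<lambda>\<xi>. 1 / (norm (?P j l \<xi> - ?P k m \<xi>))\<^sup>2)"
      "expectation (\<lambda>\<xi>. 1 / (norm (?P j l \<xi> - ?P k m \<xi>))\<^sup>2) = 1 / (2 * \<bar>z j - z k\<bar>)"
      by blast+
  qed
  have intG: "integrable M (?G j k)" if "(j, k) \<in> ?O" for j k
    by (intro Bochner_Integration.integrable_sum pair that)
  have expG: "expectation (?G j k) = 1 / 2 * (real (r j) * real (r k) / \<bar>z j - z k\<bar>)"
    if "(j, k) \<in> ?O" for j k
  proof -
    have "expectation (?G j k) = (\<Sum>l = 1..r j. \<Sum>m = 1..r k.
        expectation (\<lambda>\<xi>. 1 / (norm (?P j l \<xi> - ?P k m \<xi>))\<^sup>2))"
      by (simp only: Bochner_Integration.integral_sum Bochner_Integration.integrable_sum pair(1)[OF that])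
    also have "\<dots> = (\<Sum>l = 1..r j. \<Sum>m = 1..r k. 1 / (2 * \<bar>z j - z k\<bar>))"
      by (simp only: pair(2)[OF that])
    finally show ?thesis by simp
  qed
  have intS: "integrable M (\<lambda>\<xi>. \<Sum>(j, k)\<in>?O. ?G j k \<xi>)"
    unfolding case_prod_unfold by (intro Bochner_Integration.integrable_sum intG) auto
  have "expectation (\<lambda>\<xi>. energy2 (parallel_config p r z (\<lambda>j. \<theta> j \<xi>)))
      = expectation (\<lambda>\<xi>. ?C + (\<Sum>(j, k)\<in>?O. ?G j k \<xi>))"
    by (subst energy2_parallel_config[OF assms(2-4)]) auto
  also have "\<dots> = ?C + expectation (\<lambda>\<xi>. \<Sum>(j, k)\<in>?O. ?G j k \<xi>)"
    using Bochner_Integration.integral_add[OF integrable_const[of ?C] intS] by (simp add: prob_space)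
  also have "expectation (\<lambda>\<xi>. \<Sum>(j, k)\<in>?O. ?G j k \<xi>)
      = (\<Sum>(j, k)\<in>?O. expectation (?G j k))"
    unfolding case_prod_unfold
    by (rule Bochner_Integration.integral_sum) (rule intG, auto)
  also have "\<dots> = (\<Sum>(j, k)\<in>?O. 1 / 2 * (real (r j) * real (r k) / \<bar>z j - z k\<bar>))"
    by (rule sum.cong[OF refl]) (clarify, rule expG, simp)
  also have "\<dots> = 1 / 2 * (\<Sum>(j, k)\<in>?O. real (r j) * real (r k) / \<bar>z j - z k\<bar>)"
    by (simp add: sum_distrib_left case_prod_unfold)
  \<comment> \<open>The coefficient \<open>23 / 12\<close> is \<open>2\<close> from the two poles minus \<open>1 / 12\<close> from the linear term of
    \<open>(r ^ 3 - r) / 12\<close>.\<close>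
  also have "?C = 1 / 2 + 23 / 12 * (\<Sum>j = 1..p. real (r j) / ?c j)
      + 1 / 12 * (\<Sum>j = 1..p. real (r j) ^ 3 / ?c j)"
  proof -
    have "2 * real (r j) / ?c j + real (r j) * ((real (r j))\<^sup>2 - 1) / (12 * ?c j)
        = 23 / 12 * (real (r j) / ?c j) + 1 / 12 * (real (r j) ^ 3 / ?c j)"
      if "j \<in> {1..p}" for j
    proof -
      have "?c j \<noteq> 0"
        using assms(3)[OF that] by (auto simp: power2_eq_1_iff)
      then show ?thesis
        by (simp add: divide_simps) (simp add: algebra_simps power2_eq_square power3_eq_cube)
    qed
    then have "(\<Sum>j = 1..p. 2 * real (r j) / ?c j + real (r j) * ((real (r j))\<^sup>2 - 1) / (12 * ?c j))
        = (\<Sum>j = 1..p. 23 / 12 * (real (r j) / ?c j) + 1 / 12 * (real (r j) ^ 3 / ?c j))"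
      by (rule sum.cong[OF refl])
    then show ?thesis
      by (simp add: sum.distrib sum_distrib_left)
  qed
  finally show ?thesis .
qed

end
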